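(* Let $L$ be an infinite locally compact Hausdorff topological space that does not contain isolated points. Then every somewhat regular linear subspace of $C_0(L)$ (with the supremum norm) has the Daugavet property.
   Context: $\mathbb{K}$ denotes either $\mathbb{R}$ or $\mathbb{C}$, and $C_0(L)$ is the Banach space of continuous $\mathbb{K}$-valued functions on $L$ vanishing at infinity, with the supremum norm. A linear subspace $\mathcal{A}$ of $C_0(L)$ (not necessarily closed) is called somewhat regular if, whenever $V$ is a non-empty open subset of $L$ and $0<\varepsilon<1$, there is an $f\in\mathcal{A}$ such that $\|f\|=1$ and $|f(x)|\leq\varepsilon$ for every $x\in L\setminus V$. A normed space $X$ has the Daugavet property if every bounded linear operator $T\colon X\to X$ of rank $1$ satisfies the Daugavet equation $\|I+T\|=1+\|T\|$, where $I$ is the identity operator on $X$. *)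

theory Defs
  imports "HOL-Analysis.Analysis"
begin

section \<open>The scalar field acting on bounded continuous functions\<close>

text \<open>
  The library equips \<^typ>\<open>('a::topological_space, 'b::real_normed_vector) bcontfun\<close> with the
  supremum norm, but only with real scalars. The following scalar multiplication makes it a vector
  space over its codomain, so that real and complex scalars are treated uniformly.
\<close>

definition scale_bcontfun ::
    "'k::real_normed_field \<Rightarrow> ('a::topological_space \<Rightarrow>\<^sub>C 'k) \<Rightarrow> ('a \<Rightarrow>\<^sub>C 'k)" where
  "scale_bcontfun c f = Bcontfun (\<lambda>x. c * f x)"

lemma apply_scale_bcontfun [simp]: "scale_bcontfun c f x = c * f x"
proof -
  have "bounded ((*) c ` range f)"
    by (intro bounded_linear_image bounded_apply_bcontfun bounded_linear_mult_right)
  then have "(\<lambda>x. c * f x) \<in> bcontfun"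
    by (auto simp: bcontfun_def image_image intro!: continuous_intros)
  then show ?thesis
    by (simp add: scale_bcontfun_def Bcontfun_inverse)
qed

global_interpretation bcf:
    vector_space "scale_bcontfun :: 'k::real_normed_field \<Rightarrow> ('a::topological_space \<Rightarrow>\<^sub>C 'k) \<Rightarrow> _"
  by unfold_locales (auto intro!: bcontfun_eqI simp: algebra_simps)

lemma norm_scale_bcontfun: "norm (scale_bcontfun c f) = norm c * norm f"
proof (cases "c = 0")
  case True
  then show ?thesis by simp
next
  case False
  have le: "norm (scale_bcontfun d g) \<le> norm d * norm g" for d and g :: "'a \<Rightarrow>\<^sub>C 'b"
    by (rule norm_bound) (simp add: norm_mult norm_bounded mult_left_mono)
  have "norm f \<le> norm (inverse c) * norm (scale_bcontfun c f)"
    using le[of "inverse c" "scale_bcontfun c f"] False by simp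
  with le[of c f] False show ?thesis
    by (simp add: norm_inverse norm_divide field_simps)
qed

section \<open>Continuous functions vanishing at infinity\<close>

definition vanishes_at_infinity :: "('a::topological_space \<Rightarrow> 'b::real_normed_vector) \<Rightarrow> bool" where
  "vanishes_at_infinity f \<longleftrightarrow> (\<forall>e>0. \<exists>K. compact K \<and> (\<forall>x. x \<notin> K \<longrightarrow> norm (f x) < e))"

definition C0 :: "('a::topological_space \<Rightarrow>\<^sub>C 'b::real_normed_vector) set" where
  "C0 = {f. vanishes_at_infinity (apply_bcontfun f)}"

text \<open>Starting from bounded functions loses nothing.\<close>

lemma apply_bcontfun_C0:
  "apply_bcontfun ` C0 = {f. continuous_on UNIV f \<and> vanishes_at_infinity f}"
proof (intro equalityI subsetI)
  fix f :: "'a \<Rightarrow> 'b"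
  assume "f \<in> {f. continuous_on UNIV f \<and> vanishes_at_infinity f}"
  then have cont: "continuous_on UNIV f" and van: "vanishes_at_infinity f" by auto
  obtain K where K: "compact K" "\<And>x. x \<notin> K \<Longrightarrow> norm (f x) < 1"
    using van unfolding vanishes_at_infinity_def by (metis zero_less_one)
  have "bounded (f ` K)"
    using K(1) cont by (meson compact_continuous_image compact_imp_bounded continuous_on_subset top_greatest)
  moreover have "range f \<subseteq> f ` K \<union> ball 0 1"
    using K(2) by (force simp: image_iff)
  ultimately have "bounded (range f)"
    by (meson bounded_Un bounded_ball bounded_subset)
  with cont have "f \<in> bcontfun" by (simp add: bcontfun_def)
  then obtain g where "f = apply_bcontfun g" by (rule bcontfunE)
  with van show "f \<in> apply_bcontfun ` C0" by (auto simp: C0_def)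
qed (auto simp: C0_def)

definition somewhat_regular :: "('a::topological_space \<Rightarrow>\<^sub>C 'k::real_normed_field) set \<Rightarrow> bool" where
  "somewhat_regular A \<longleftrightarrow>
     bcf.subspace A \<and> A \<subseteq> C0 \<and>
     (\<forall>V e. open V \<and> V \<noteq> {} \<and> 0 < e \<and> e < 1 \<longrightarrow>
        (\<exists>f\<in>A. norm f = 1 \<and> (\<forall>x. x \<notin> V \<longrightarrow> norm (apply_bcontfun f x) \<le> e)))"

section \<open>The Daugavet property\<close>

text \<open>
  A normed space is given as a linear subspace \<open>X\<close> of a normed type with scalar multiplication
  \<open>s\<close>. An operator on \<open>X\<close> is a function on the whole type of which only the values on \<open>X\<close>
  matter; accordingly, linearity, boundedness and the norm are taken relative to \<open>X\<close>.
\<close>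

definition bounded_operator_on ::
    "('k::real_normed_field \<Rightarrow> 'b::real_normed_vector \<Rightarrow> 'b) \<Rightarrow> 'b set \<Rightarrow> ('b \<Rightarrow> 'b) \<Rightarrow> bool" where
  "bounded_operator_on s X T \<longleftrightarrow>
     T ` X \<subseteq> X \<and>
     (\<forall>x\<in>X. \<forall>y\<in>X. T (x + y) = T x + T y) \<and>
     (\<forall>c. \<forall>x\<in>X. T (s c x) = s c (T x)) \<and>
     (\<exists>B. \<forall>x\<in>X. norm (T x) \<le> B * norm x)"

text \<open>\<^const>\<open>onorm\<close>, relativised to \<open>X\<close>.\<close>

definition onorm_on :: "'b::real_normed_vector set \<Rightarrow> ('b \<Rightarrow> 'b) \<Rightarrow> real" where
  "onorm_on X T = (SUP x\<in>X. norm (T x) / norm x)"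

definition Daugavet_property ::
    "('k::real_normed_field \<Rightarrow> 'b::real_normed_vector \<Rightarrow> 'b) \<Rightarrow> 'b set \<Rightarrow> bool" where
  "Daugavet_property s X \<longleftrightarrow>
     (\<forall>T. bounded_operator_on s X T \<and> vector_space.dim s (T ` X) = 1 \<longrightarrow>
        onorm_on X (\<lambda>x. x + T x) = 1 + onorm_on X T)"

end

theory Submission
  imports Defs
begin

text \<open>
  Averaging a nested sequence of peak functions, each supported where the preceding ones are nearly
  \<open>1\<close>, yields elements of a somewhat regular subspace that are nearly \<open>[0,1]\<close>-valued, close to \<open>1\<close>
  at some point of a given open set and small outside it. In the absence of isolated points such
  bumps can be placed in many disjoint open sets, so a bounded functional \<open>\<phi>\<close> is small on one of
  them, and no representing measure is needed. For \<open>T = \<phi> g\<close> and \<open>f\<close> nearly norming \<open>\<phi>\<close>, adding a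
  multiple of such a bump to \<open>f\<close> moves \<open>f\<close> along a segment in the unit ball of the scalars, up to a
  small error, until it is aligned with \<open>g\<close> where \<open>\<bar>g\<bar>\<close> is nearly maximal; the value of \<open>\<phi>\<close> hardly
  changes.
\<close>

section \<open>Bumps in somewhat regular subspaces\<close>

lemma ex_unimodular:
  fixes z :: "'k::real_normed_field"
  obtains c where "norm c = 1" "c * z = of_real (norm z)"
proof (cases "z = 0")
  case True
  then show ?thesis using that[of 1] by simp
next
  case False
  then show ?thesis using that[of "of_real (norm z) / z"] by (simp add: norm_divide)
qed

lemma norm_bcontfun_approx:
  fixes f :: "'a::topological_space \<Rightarrow>\<^sub>C 'b::real_normed_vector"
  assumes "b < norm f"
  obtains x where "b < norm (f x)"
  using norm_bound[of f b] assms by (meson not_le)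

lemma open_bcontfun_near:
  fixes f :: "'a::topological_space \<Rightarrow>\<^sub>C 'b::real_normed_vector"
  shows "open {x. norm (f x - c) < d}"
  by (intro open_Collect_less continuous_intros continuous_on_apply_bcontfun)

text \<open>The supremum norm 1 need not be attained, so \<open>x\<close> is only a near-maximum of
  the modulus. A unimodular factor turns the value there towards 1. Since \<open>e < 1/2\<close>, a
  value of modulus above \<open>1 - e\<close> cannot occur outside \<open>V\<close>.\<close>

lemma somewhat_regular_peak:
  fixes A :: "('a::topological_space \<Rightarrow>\<^sub>C 'k::real_normed_field) set"
  assumes A: "somewhat_regular A" and V: "open V" "V \<noteq> {}" and "0 < e" "e < 1/2"
  obtains h x where "h \<in> A" "norm h = 1" "x \<in> V" "norm (h x - 1) < e"
    "\<And>y. y \<notin> V \<Longrightarrow> norm (h y) \<le> e"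
proof -
  obtain h where h: "h \<in> A" "norm h = 1" "\<And>y. y \<notin> V \<Longrightarrow> norm (h y) \<le> e"
    using A V \<open>0 < e\<close> \<open>e < 1/2\<close> unfolding somewhat_regular_def
    by (smt (verit) field_sum_of_halves)
  obtain x where x: "1 - e < norm (h x)"
    using norm_bcontfun_approx[of "1 - e" h] h(2) \<open>0 < e\<close> by auto
  obtain c where c: "norm c = 1" "c * h x = of_real (norm (h x))" by (rule ex_unimodular)
  show ?thesis
  proof
    show "scale_bcontfun c h \<in> A"
      using A h(1) by (simp add: somewhat_regular_def bcf.subspace_scale)
    show "norm (scale_bcontfun c h) = 1" by (simp add: norm_scale_bcontfun c h)
    show "x \<in> V" using h(3)[of x] x \<open>e < 1/2\<close> by force
    have "norm (h x) \<le> 1" using norm_bounded[of h x] h(2) by simp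
    moreover have "norm (of_real (norm (h x)) - 1 :: 'k) = \<bar>norm (h x) - 1\<bar>"
      by (metis norm_of_real of_real_1 of_real_diff)
    ultimately show "norm (scale_bcontfun c h x - 1) < e" using x by (simp add: c)
  qed (simp add: norm_mult c h)
qed

text \<open>A substitute for a Urysohn function. Closeness to the real segment [0,1], rather than a
  bound on the modulus, is what later keeps a perturbed function near a convex combination.\<close>

definition approx_bump ::
    "('a::topological_space \<Rightarrow>\<^sub>C 'k::real_normed_field) \<Rightarrow> 'a set \<Rightarrow> real \<Rightarrow> bool" where
  "approx_bump h V e \<longleftrightarrow>
     (\<exists>x\<in>V. norm (h x - 1) \<le> e) \<and>
     (\<forall>x. \<exists>t\<in>{0..1}. norm (h x - of_real t) \<le> e) \<and>
     (\<forall>x. x \<notin> V \<longrightarrow> norm (h x) \<le> e)"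

lemma approx_bump_mono:
  assumes "approx_bump h V e" "V \<subseteq> W" "e \<le> d"
  shows "approx_bump h W d"
  using assms unfolding approx_bump_def by (meson order_trans subsetD)

lemma approx_bump_norm_le:
  fixes h :: "'a::topological_space \<Rightarrow>\<^sub>C 'k::real_normed_field"
  assumes "approx_bump h V e"
  shows "norm h \<le> 1 + e"
proof (rule norm_bound)
  fix x
  obtain t where t: "t \<in> {0..1}" "norm (h x - of_real t) \<le> e"
    using assms unfolding approx_bump_def by blast
  have "norm (h x) \<le> norm (of_real t :: 'k) + norm (h x - of_real t)"
    using norm_triangle_sub by blast
  then show "norm (h x) \<le> 1 + e" using t by simp
qed

text \<open>Each new peak \<open>h\<close> is followed by a sum \<open>S\<close> living on the set
  \<open>W\<close> where \<open>h\<close> is already near 1. Only one peak at a time has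
  uncontrolled values at a given point, so the error stays at \<open>1 + d\<close> however large
  \<open>n\<close> is; dividing by \<open>n\<close> will make it small. The tolerance is halved at
  each step.\<close>

lemma nested_peak_sum:
  fixes A :: "('a::topological_space \<Rightarrow>\<^sub>C 'k::real_normed_field) set"
  assumes A: "somewhat_regular A" and "open V" "V \<noteq> {}" "0 < d" "d < 1"
  shows "\<exists>S\<in>A. (\<exists>x\<in>V. norm (S x - of_nat n) \<le> d) \<and>
     (\<forall>x. \<exists>t\<in>{0..real n}. norm (S x - of_real t) \<le> 1 + d) \<and>
     (\<forall>x. x \<notin> V \<longrightarrow> norm (S x) \<le> d)"
  using assms(2-)
proof (induction n arbitrary: V d)
  case 0
  then show ?case
    using A by (intro bexI[of _ 0]) (auto simp: somewhat_regular_def bcf.subspace_0)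
next
  case (Suc n)
  obtain h z where h: "h \<in> A" "norm h = 1" "z \<in> V" "norm (h z - 1) < d/2"
    "\<And>y. y \<notin> V \<Longrightarrow> norm (h y) \<le> d/2"
    using somewhat_regular_peak[OF A Suc.prems(1,2), of "d/2"] Suc.prems by auto
  define W where "W = V \<inter> {x. norm (h x - 1) < d/2}"
  have W: "open W" "W \<noteq> {}"
    using h Suc.prems by (auto simp: W_def intro!: open_Int open_bcontfun_near simp del: less_divide_eq_numeral1)
  obtain S x where S: "S \<in> A" "x \<in> W" "norm (S x - of_nat n) \<le> d/2"
    "\<And>x. \<exists>t\<in>{0..real n}. norm (S x - of_real t) \<le> 1 + d/2"
    "\<And>x. x \<notin> W \<Longrightarrow> norm (S x) \<le> d/2"
    using Suc.IH[OF W, of "d/2"] Suc.prems by auto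
  have "h + S \<in> A" using A h(1) S(1) by (simp add: somewhat_regular_def bcf.subspace_add)
  moreover have "norm ((h + S) x - of_nat (Suc n)) \<le> d"
  proof -
    have "(h + S) x - of_nat (Suc n) = (h x - 1) + (S x - of_nat n)" by simp
    also have "norm \<dots> \<le> d/2 + d/2"
      using S(2,3) by (intro norm_triangle_mono) (auto simp: W_def)
    finally show ?thesis by simp
  qed
  moreover have "\<exists>t\<in>{0..real (Suc n)}. norm ((h + S) y - of_real t) \<le> 1 + d" for y
  proof (cases "y \<in> W")
    case True
    obtain t where t: "t \<in> {0..real n}" "norm (S y - of_real t) \<le> 1 + d/2" using S(4) by blast
    have "(h + S) y - of_real (1 + t) = (h y - 1) + (S y - of_real t)" by simp
    also have "norm \<dots> \<le> d/2 + (1 + d/2)"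
      using t True by (intro norm_triangle_mono) (auto simp: W_def)
    finally show ?thesis using t by (intro bexI[of _ "1 + t"]) auto
  next
    case False
    \<comment> \<open>Off \<open>W\<close> the values of \<open>h\<close> are arbitrary in the unit
      ball while \<open>S\<close> is negligible: here the allowance 1 is spent, with 0 as the
      reference value.\<close>
    have "norm (h y) \<le> 1" using norm_bounded[of h y] h(2) by simp
    then have "norm ((h + S) y) \<le> 1 + d/2"
      using S(5)[OF False] by (auto intro: norm_triangle_mono)
    then show ?thesis using \<open>0 < d\<close> by (intro bexI[of _ 0]) auto
  qed
  moreover have "norm ((h + S) y) \<le> d" if "y \<notin> V" for y
  proof -
    have "y \<notin> W" using that by (simp add: W_def)
    then have "norm (h y + S y) \<le> d/2 + d/2" using h(5) S(5) that by (intro norm_triangle_mono) auto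
    then show ?thesis by simp
  qed
  ultimately show ?case using S(2) unfolding W_def by blast
qed

lemma ex_approx_bump:
  fixes A :: "('a::topological_space \<Rightarrow>\<^sub>C 'k::real_normed_field) set"
  assumes A: "somewhat_regular A" and V: "open V" "V \<noteq> {}" and "0 < e"
  obtains h where "h \<in> A" "approx_bump h V e"
proof -
  \<comment> \<open>All errors of the nested sum are at most \<open>1 + 1/2\<close>, hence below 2,
    so division by \<open>n\<close> brings them under \<open>2 / n\<close>, which is at most
    \<open>e\<close>.\<close>
  obtain m :: nat where m: "2 / e < real m" using reals_Archimedean2 by blast
  define n where "n = Suc m"
  have n: "2 \<le> e * n" "n > 0" using m \<open>0 < e\<close> by (auto simp: n_def field_simps)
  obtain S x where S: "S \<in> A" "x \<in> V" "norm (S x - of_nat n) \<le> 1/2"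
    "\<And>x. \<exists>t\<in>{0..real n}. norm (S x - of_real t) \<le> 1 + 1/2"
    "\<And>x. x \<notin> V \<Longrightarrow> norm (S x) \<le> 1/2"
    using nested_peak_sum[OF A V, of "1/2" n] by auto
  define h where "h = scale_bcontfun (inverse (of_nat n)) S"
  have scale: "norm (h y - of_real (t / n)) \<le> e" if "norm (S y - of_real t) \<le> 2" for y t
  proof -
    have "h y - of_real (t / n) = (S y - of_real t) / of_nat n"
      using n by (simp add: h_def field_simps)
    then have "norm (h y - of_real (t / n)) = norm (S y - of_real t) / n"
      by (simp add: norm_divide)
    also have "\<dots> \<le> e" using that n by (simp add: divide_le_eq)
    finally show ?thesis .
  qed
  have "h \<in> A" using A S(1) by (simp add: h_def somewhat_regular_def bcf.subspace_scale)
  moreover have "approx_bump h V e"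
    unfolding approx_bump_def
  proof (intro conjI allI impI)
    show "\<exists>x\<in>V. norm (h x - 1) \<le> e"
      using scale[of x "real n"] S n by (intro bexI[of _ x]) auto
    show "\<exists>t\<in>{0..1}. norm (h y - of_real t) \<le> e" for y
    proof -
      obtain t where "t \<in> {0..real n}" "norm (S y - of_real t) \<le> 1 + 1/2" using S(4) by blast
      then show ?thesis using scale[of y t] n by (intro bexI[of _ "t / n"]) auto
    qed
    show "norm (h y) \<le> e" if "y \<notin> V" for y
      using scale[of y 0] S(5)[OF that] by simp
  qed
  ultimately show ?thesis by (rule that)
qed

section \<open>Functionals that are small on a bump\<close>

text \<open>Without isolated points a non-empty open set has two points, and the Hausdorff property
  separates them.\<close>

lemma disjoint_open_subsets:
  fixes V :: "'a::t2_space set"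
  assumes "\<And>x::'a. \<not> x isolated_in UNIV" "open V" "V \<noteq> {}"
  obtains U W where "open U" "open W" "U \<noteq> {}" "W \<noteq> {}" "U \<subseteq> V" "W \<subseteq> V" "U \<inter> W = {}"
proof -
  obtain x where x: "x \<in> V" using assms by blast
  have "V \<noteq> {x}" using assms unfolding isolated_in_def by auto
  then obtain y where y: "y \<in> V" "y \<noteq> x" using x by blast
  obtain U W where "open U" "open W" "x \<in> U" "y \<in> W" "U \<inter> W = {}"
    using hausdorff[of x y] y by metis
  then show ?thesis using that[of "U \<inter> V" "W \<inter> V"] x y assms by auto
qed

text \<open>Otherwise \<open>\<phi>\<close> exceeds \<open>e\<close> in modulus on every bump in
  \<open>V\<close>. Rotated bumps on disjoint pieces then add up to elements of norm at most
  \<open>1 + e\<close> whose images under \<open>\<phi>\<close> grow without bound.\<close>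

lemma ex_approx_bump_small:
  fixes A :: "('a::t2_space \<Rightarrow>\<^sub>C 'k::real_normed_field) set"
  assumes A: "somewhat_regular A" and iso: "\<And>x::'a. \<not> x isolated_in UNIV"
    and add: "\<And>f g. f \<in> A \<Longrightarrow> g \<in> A \<Longrightarrow> \<phi> (f + g) = \<phi> f + \<phi> g"
    and scale: "\<And>c f. f \<in> A \<Longrightarrow> \<phi> (scale_bcontfun c f) = c * \<phi> f"
    and bound: "\<And>f. f \<in> A \<Longrightarrow> norm (\<phi> f) \<le> B * norm f"
    and V: "open V" "V \<noteq> {}" and "0 < e"
  shows "\<exists>h\<in>A. approx_bump h V e \<and> norm (\<phi> h) \<le> e"
proof (rule ccontr)
  assume contra: "\<not> ?thesis"
  have large: "e < norm (\<phi> h)" if "h \<in> A" "approx_bump h W d" "W \<subseteq> V" "d \<le> e" for h W d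
    using that contra approx_bump_mono[of h W d V e] by (meson not_le)
  \<comment> \<open>The sum built so far is placed in \<open>U'\<close>, leaving the disjoint
    \<open>U\<close> for the next bump. Keeping \<open>\<phi> S\<close> real and nonnegative rules
    out cancellation.\<close>
  have "\<exists>S\<in>A. norm S \<le> 1 + d \<and> (\<forall>x. x \<notin> W \<longrightarrow> norm (apply_bcontfun S x) \<le> d) \<and>
      (\<exists>r\<ge>real n * e. \<phi> S = of_real r)"
    if "open W" "W \<noteq> {}" "W \<subseteq> V" "0 < d" "d \<le> e" for n :: nat and W d
    using that
  proof (induction n arbitrary: W d)
    case 0
    have "(0 :: 'a \<Rightarrow>\<^sub>C 'k) \<in> A" using A by (simp add: somewhat_regular_def bcf.subspace_0)
    moreover from this have "\<phi> 0 = 0" using bound[of 0] by simp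
    ultimately show ?case using 0 by (intro bexI[of _ 0]) (auto intro!: exI[of _ "0::real"])
  next
    case (Suc n)
    obtain U U' where U: "open U" "open U'" "U \<noteq> {}" "U' \<noteq> {}" "U \<subseteq> W" "U' \<subseteq> W" "U \<inter> U' = {}"
      using disjoint_open_subsets[OF iso Suc.prems(1,2)] .
    have "U' \<subseteq> V" "0 < d/2" "d/2 \<le> e" using Suc.prems U by auto
    then obtain S r where S: "S \<in> A" "norm S \<le> 1 + d/2" "\<And>x. x \<notin> U' \<Longrightarrow> norm (S x) \<le> d/2"
      "r \<ge> real n * e" "\<phi> S = of_real r"
      using Suc.IH[OF \<open>open U'\<close> \<open>U' \<noteq> {}\<close>] by blast
    obtain h where h: "h \<in> A" "approx_bump h U (d/2)"
      using ex_approx_bump[OF A \<open>open U\<close> \<open>U \<noteq> {}\<close>, of "d/2"] Suc.prems by auto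
    obtain c where c: "norm c = 1" "c * \<phi> h = of_real (norm (\<phi> h))" by (rule ex_unimodular)
    define S' where "S' = S + scale_bcontfun c h"
    have le: "norm (S' x) \<le> norm (S x) + norm (h x)" for x
      unfolding S'_def using norm_triangle_ineq[of "S x" "c * h x"] by (simp add: norm_mult c)
    have hoff: "norm (h x) \<le> d/2" if "x \<notin> U" for x
      using h(2) that by (simp add: approx_bump_def)
    have hU: "norm (h x) \<le> 1 + d/2" for x
      using approx_bump_norm_le[OF h(2)] norm_bounded[of h x] by linarith
    have SU: "norm (S x) \<le> 1 + d/2" for x
      using S(2) norm_bounded[of S x] by linarith
    show ?case
    proof (intro bexI[of _ S'] conjI allI impI)
      show "S' \<in> A"
        using A S(1) h(1) by (simp add: S'_def somewhat_regular_def bcf.subspace_add bcf.subspace_scale)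
      \<comment> \<open>At every point at most one of the two summands exceeds \<open>d/2\<close> in
        modulus.\<close>
      show "norm S' \<le> 1 + d"
      proof (rule norm_bound)
        fix x
        show "norm (S' x) \<le> 1 + d"
        proof (cases "x \<in> U")
          case True
          then have "x \<notin> U'" using U by blast
          then show ?thesis using le[of x] S(3)[of x] hU[of x] by simp
        next
          case False
          then show ?thesis using le[of x] SU[of x] hoff[of x] by simp
        qed
      qed
      show "norm (S' x) \<le> d" if "x \<notin> W" for x
        using le[of x] S(3)[of x] hoff[of x] U that by force
      have "e < norm (\<phi> h)" using large[OF h] Suc.prems U by auto
      moreover have "scale_bcontfun c h \<in> A"
        using A h(1) by (simp add: somewhat_regular_def bcf.subspace_scale)
      ultimately show "\<exists>r\<ge>real (Suc n) * e. \<phi> S' = of_real r"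
        using S c h(1) by (intro exI[of _ "r + norm (\<phi> h)"]) (simp add: S'_def add scale algebra_simps)
    qed
  qed
  note sums = this[OF V subset_refl \<open>0 < e\<close> order_refl]
  \<comment> \<open>The sign of \<open>B\<close> is unknown; its absolute value makes the bound
    monotone in the norm.\<close>
  obtain n :: nat where n: "\<bar>B\<bar> * (1 + e) / e < n" using reals_Archimedean2 by blast
  obtain S r where S: "S \<in> A" "norm S \<le> 1 + e" "r \<ge> real n * e" "\<phi> S = of_real r"
    using sums[of n] by blast
  have "real n * e \<le> norm (\<phi> S)" using S by simp
  also have "\<dots> \<le> \<bar>B\<bar> * norm S"
    using bound[OF S(1)] by (meson abs_ge_self mult_right_mono norm_ge_zero order_trans)
  also have "\<dots> \<le> \<bar>B\<bar> * (1 + e)" using S by (intro mult_left_mono) auto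
  finally show False using n \<open>0 < e\<close> by (simp add: field_simps)
qed

section \<open>The Daugavet equation\<close>

text \<open>The witness \<open>F\<close> is close to a unimodular \<open>w\<close> at a point where
  \<open>g\<close> is close to \<open>w\<close> too, while \<open>\<phi> F\<close> stays close to
  the nonnegative real \<open>r\<close>. Hence \<open>F + \<phi>(F) g\<close> is close to
  \<open>(1 + r) w\<close> there.\<close>

lemma almost_Daugavet:
  fixes A :: "('a::t2_space \<Rightarrow>\<^sub>C 'k::real_normed_field) set"
  assumes A: "somewhat_regular A" and iso: "\<And>x::'a. \<not> x isolated_in UNIV"
    and add: "\<And>f g. f \<in> A \<Longrightarrow> g \<in> A \<Longrightarrow> \<phi> (f + g) = \<phi> f + \<phi> g"
    and scale: "\<And>c f. f \<in> A \<Longrightarrow> \<phi> (scale_bcontfun c f) = c * \<phi> f"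
    and bound: "\<And>f. f \<in> A \<Longrightarrow> norm (\<phi> f) \<le> B * norm f"
    and g: "norm g = 1" and f0: "f0 \<in> A" "norm f0 \<le> 1" and "0 < e"
  shows "\<exists>f\<in>A. norm f \<le> 1 + e \<and> 1 + norm (\<phi> f0) - e \<le> norm (f + scale_bcontfun (\<phi> f) g)"
proof -
  define r where "r = norm (\<phi> f0)"
  have "0 \<le> r" by (simp add: r_def)
  obtain c where c: "norm c = 1" "c * \<phi> f0 = of_real r"
    unfolding r_def by (rule ex_unimodular)
  define f where "f = scale_bcontfun c f0"
  have f: "f \<in> A" "norm f \<le> 1" "\<phi> f = of_real r"
    using A f0 c by (auto simp: f_def scale norm_scale_bcontfun somewhat_regular_def bcf.subspace_scale)
  \<comment> \<open>The remainder \<open>R\<close> below is bounded by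
    \<open>(5 + 2 * r) * d\<close>, and the excess of \<open>norm F\<close> over 1 by
    \<open>3 * d\<close>. The cap \<open>1/2\<close> ensures that \<open>g p\<close> is
    nonzero.\<close>
  define d where "d = min (1/2) (e / (5 + 2 * r))"
  have d: "0 < d" "d < 1" "(5 + 2 * r) * d \<le> e"
    using \<open>0 \<le> r\<close> \<open>0 < e\<close> pos_le_divide_eq[of "5 + 2 * r" d e]
    by (auto simp: d_def mult.commute)
  have de: "3 * d \<le> e"
  proof -
    have "3 * d \<le> (5 + 2 * r) * d" using \<open>0 \<le> r\<close> d by (intro mult_right_mono) auto
    then show ?thesis using d(3) by linarith
  qed
  obtain p where p: "1 - d < norm (g p)"
    using norm_bcontfun_approx[of "1 - d" g] g d by auto
  have gp: "g p \<noteq> 0" using p d by auto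
  define w where "w = g p / of_real (norm (g p))"
  have w: "norm w = 1" using gp by (simp add: w_def norm_divide)
  have gw: "norm (g p - w) \<le> d"
  proof -
    have "g p - w = w * of_real (norm (g p) - 1)" using gp by (simp add: w_def field_simps)
    then have "norm (g p - w) = \<bar>norm (g p) - 1\<bar>" by (simp only: norm_mult w norm_of_real mult_1)
    then show ?thesis using p norm_bounded[of g p] g by simp
  qed
  define a where "a = f p"
  have a: "norm a \<le> 1" using norm_bounded[of f p] f(2) by (simp add: a_def)
  have wa: "norm (w - a) \<le> 2" using norm_triangle_ineq4[of w a] w a by simp
  \<comment> \<open>Near \<open>p\<close> both functions are almost constant, so a bump in
    \<open>V\<close> with coefficient \<open>w - a\<close> replaces the value \<open>a\<close> of
    \<open>f\<close> by \<open>w\<close>.\<close>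
  define V where "V = {x. norm (g x - g p) < d} \<inter> {x. norm (f x - a) < d}"
  have "p \<in> V" using d by (simp add: V_def a_def)
  have V: "open V" "V \<noteq> {}"
    using \<open>p \<in> V\<close> by (unfold V_def, intro open_Int open_bcontfun_near) blast
  obtain h where h: "h \<in> A" "approx_bump h V d" "norm (\<phi> h) \<le> d"
    using ex_approx_bump_small[OF A iso add scale bound V d(1)] by blast
  define F where "F = f + scale_bcontfun (w - a) h"
  have F: "F x = f x + (w - a) * h x" for x by (simp add: F_def)
  have hA: "scale_bcontfun (w - a) h \<in> A"
    using A h(1) by (simp add: somewhat_regular_def bcf.subspace_scale)
  have wad: "norm ((w - a) * z) \<le> 2 * d" if "norm z \<le> d" for z
    unfolding norm_mult using wa that by (intro mult_mono) auto
  have "F \<in> A" using A f(1) hA by (simp add: F_def somewhat_regular_def bcf.subspace_add)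
  moreover have "norm F \<le> 1 + e"
  proof (rule norm_bound)
    fix x
    show "norm (F x) \<le> 1 + e"
    proof (cases "x \<in> V")
      case True
      obtain t where t: "0 \<le> t" "t \<le> 1" "norm (h x - of_real t) \<le> d"
        using h(2) unfolding approx_bump_def by (meson atLeastAtMost_iff)
      \<comment> \<open>Where \<open>h\<close> is near \<open>t\<close>, \<open>F\<close> is near a
        point of the segment from \<open>a\<close> to \<open>w\<close>, which lies in the unit
        ball.\<close>
      have "F x = (of_real (1 - t) * a + of_real t * w) + ((f x - a) + (w - a) * (h x - of_real t))"
        by (simp add: F algebra_simps)
      also have "norm \<dots> \<le> ((1 - t) * 1 + t * 1) + (d + 2 * d)"
      proof (intro norm_triangle_mono wad t)
        show "norm (of_real (1 - t) * a) \<le> (1 - t) * 1"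
          unfolding norm_mult norm_of_real using t a by (intro mult_mono) auto
        show "norm (of_real t * w) \<le> t * 1" using t w by (simp add: norm_mult)
        show "norm (f x - a) \<le> d" using True by (simp add: V_def)
      qed
      finally show ?thesis using de by simp
    next
      case False
      then have "norm ((w - a) * h x) \<le> 2 * d" using wad h(2) by (simp add: approx_bump_def)
      moreover have "norm (f x) \<le> 1" using norm_bounded[of f x] f(2) by simp
      ultimately have "norm (F x) \<le> 1 + 2 * d" unfolding F by (intro norm_triangle_mono)
      then show ?thesis using de d by simp
    qed
  qed
  moreover have "1 + r - e \<le> norm (F + scale_bcontfun (\<phi> F) g)"
  proof -
    obtain x where x: "x \<in> V" "norm (h x - 1) \<le> d" using h(2) unfolding approx_bump_def by blast
    have phiF: "\<phi> F = of_real r + (w - a) * \<phi> h"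
      using f hA h(1) by (simp add: F_def add scale)
    have gx: "norm (g x - w) \<le> 2 * d"
    proof -
      have "norm ((g x - g p) + (g p - w)) \<le> d + d"
        using x gw by (intro norm_triangle_mono) (auto simp: V_def)
      then show ?thesis by simp
    qed
    have g1: "norm (g x) \<le> 1" using norm_bounded[of g x] g by simp
    \<comment> \<open>\<open>R\<close> is the deviation of the sum from \<open>(1 + r) * w\<close>
      at \<open>x\<close>: the first two terms come from \<open>F\<close>, the last two from
      \<open>\<phi> F\<close> times \<open>g\<close>.\<close>
    define R where "R = ((f x - a) + (w - a) * (h x - 1)) + (of_real r * (g x - w) + (w - a) * \<phi> h * g x)"
    have "norm R \<le> (d + 2 * d) + (r * (2 * d) + 2 * d * 1)"
      unfolding R_def
    proof (intro norm_triangle_mono wad x)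
      show "norm (f x - a) \<le> d" using x by (simp add: V_def)
      show "norm (of_real r * (g x - w)) \<le> r * (2 * d)"
        unfolding norm_mult norm_of_real using \<open>0 \<le> r\<close> gx by (intro mult_mono) auto
      show "norm ((w - a) * \<phi> h * g x) \<le> 2 * d * 1"
        unfolding norm_mult[of "(w - a) * \<phi> h"] using g1 wad[OF h(3)] d by (intro mult_mono) auto
    qed
    then have R: "norm R \<le> e" using d(3) by (simp add: algebra_simps)
    have "(F + scale_bcontfun (\<phi> F) g) x = of_real (1 + r) * w + R"
      by (simp add: R_def F phiF algebra_simps)
    moreover have "norm (of_real (1 + r) * w) = 1 + r"
      unfolding norm_mult norm_of_real w using \<open>0 \<le> r\<close> by simp
    ultimately have "1 + r - e \<le> norm ((F + scale_bcontfun (\<phi> F) g) x)"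
      using R norm_diff_ineq[of "of_real (1 + r) * w" R] by simp
    then show ?thesis using norm_bounded order_trans by blast
  qed
  ultimately show ?thesis unfolding r_def by blast
qed

text \<open>Normalising a basis vector of the range gives \<open>g\<close>. Evaluation at a point
  where \<open>g\<close> does not vanish recovers the coefficient, so \<open>\<phi>\<close> inherits
  linearity from \<open>T\<close>; as \<open>g\<close> has norm 1, it also inherits the
  bound.\<close>

lemma rank_one_representation:
  fixes X :: "('a::topological_space \<Rightarrow>\<^sub>C 'k::real_normed_field) set"
  assumes T: "bounded_operator_on scale_bcontfun X T" and X: "bcf.subspace X"
    and dim: "vector_space.dim scale_bcontfun (T ` X) = 1"
  obtains g \<phi> B where "norm g = 1" "\<And>f. f \<in> X \<Longrightarrow> T f = scale_bcontfun (\<phi> f) g"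
    "\<And>f h. f \<in> X \<Longrightarrow> h \<in> X \<Longrightarrow> \<phi> (f + h) = \<phi> f + \<phi> h"
    "\<And>c f. f \<in> X \<Longrightarrow> \<phi> (scale_bcontfun c f) = c * \<phi> f"
    "\<And>f. f \<in> X \<Longrightarrow> norm (\<phi> f) \<le> B * norm f"
proof -
  obtain B where B: "bcf.independent B" "T ` X \<subseteq> bcf.span B" "card B = 1"
    using bcf.basis_exists[of "T ` X"] dim by metis
  obtain b where b: "B = {b}" using B(3) card_1_singletonE by blast
  have "b \<noteq> 0" using B(1) b by (metis bcf.dependent_zero insertI1)
  define g where "g = scale_bcontfun (of_real (inverse (norm b))) b"
  have g: "norm g = 1" using \<open>b \<noteq> 0\<close> by (simp add: g_def norm_scale_bcontfun norm_inverse)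
  obtain p where "0 < norm (g p)" using norm_bcontfun_approx[of 0 g] g by auto
  then have p: "g p \<noteq> 0" by simp
  define \<phi> where "\<phi> f = T f p / g p" for f
  have rep: "T f = scale_bcontfun (\<phi> f) g" if f: "f \<in> X" for f
  proof -
    obtain k where "T f = scale_bcontfun k b"
      using B(2) b f bcf.span_singleton[of b] by auto
    then have k: "T f = scale_bcontfun (k * of_real (norm b)) g"
      using \<open>b \<noteq> 0\<close> by (simp add: g_def)
    then have "\<phi> f = k * of_real (norm b)" using p by (simp add: \<phi>_def)
    then show ?thesis using k by simp
  qed
  obtain M where M: "\<And>f. f \<in> X \<Longrightarrow> norm (T f) \<le> M * norm f"
    using T unfolding bounded_operator_on_def by blast
  show ?thesis
  proof
    show "\<phi> (f + h) = \<phi> f + \<phi> h" if "f \<in> X" "h \<in> X" for f h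
      using T that by (simp add: \<phi>_def bounded_operator_on_def add_divide_distrib)
    show "\<phi> (scale_bcontfun c f) = c * \<phi> f" if "f \<in> X" for c f
      using T that by (simp add: \<phi>_def bounded_operator_on_def)
    show "norm (\<phi> f) \<le> M * norm f" if "f \<in> X" for f
      using M[OF that] rep[OF that] g by (simp add: norm_scale_bcontfun)
  qed (fact g rep)+
qed

text \<open>Boundedness of \<open>T\<close> makes the set of quotients bounded above, so that the
  supremum in \<open>onorm_on\<close> really dominates each of them. At the zero vector the quotient
  is 0 by convention.\<close>

lemma onorm_on_upper:
  assumes "\<And>f. f \<in> X \<Longrightarrow> norm (T f) \<le> B * norm f" "f \<in> X"
  shows "norm (T f) \<le> onorm_on X T * norm f"
proof (cases "f = 0")
  case True
  then show ?thesis using assms(1)[OF assms(2)] by simp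
next
  case False
  have "norm (T h) / norm h \<le> \<bar>B\<bar>" if "h \<in> X" for h
  proof -
    have "norm (T h) \<le> \<bar>B\<bar> * norm h"
      using assms(1)[OF that] by (meson abs_ge_self mult_right_mono norm_ge_zero order_trans)
    then show ?thesis by (cases "h = 0") (simp_all add: divide_le_eq)
  qed
  then have "bdd_above ((\<lambda>x. norm (T x) / norm x) ` X)" by (auto intro!: bdd_aboveI)
  then have "norm (T f) / norm f \<le> onorm_on X T"
    unfolding onorm_on_def by (rule cSUP_upper[OF assms(2)])
  then show ?thesis using False by (simp add: divide_le_eq)
qed

text \<open>One inequality is the triangle inequality. For the other, \<open>almost_Daugavet\<close>
  is applied to a normalised, nearly norming element, and the slack tends to 0.\<close>

lemma somewhat_regular_Daugavet:
  fixes A :: "('a::t2_space \<Rightarrow>\<^sub>C 'k::real_normed_field) set"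
  assumes A: "somewhat_regular A" and iso: "\<And>x::'a. \<not> x isolated_in UNIV"
  shows "Daugavet_property scale_bcontfun A"
  unfolding Daugavet_property_def
proof (intro allI impI, elim conjE)
  fix T :: "('a \<Rightarrow>\<^sub>C 'k) \<Rightarrow> ('a \<Rightarrow>\<^sub>C 'k)"
  assume T: "bounded_operator_on scale_bcontfun A T"
    and dim: "vector_space.dim scale_bcontfun (T ` A) = 1"
  have sub: "bcf.subspace A" using A by (simp add: somewhat_regular_def)
  have zero: "0 \<in> A" using sub by (rule bcf.subspace_0)
  obtain g \<phi> B where g: "norm g = 1" and rep: "\<And>f. f \<in> A \<Longrightarrow> T f = scale_bcontfun (\<phi> f) g"
    and add: "\<And>f h. f \<in> A \<Longrightarrow> h \<in> A \<Longrightarrow> \<phi> (f + h) = \<phi> f + \<phi> h"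
    and scale: "\<And>c f. f \<in> A \<Longrightarrow> \<phi> (scale_bcontfun c f) = c * \<phi> f"
    and bound: "\<And>f. f \<in> A \<Longrightarrow> norm (\<phi> f) \<le> B * norm f"
    by (rule rank_one_representation[OF T sub dim]) blast
  have normT: "norm (T f) = norm (\<phi> f)" if "f \<in> A" for f
    using rep[OF that] g by (simp add: norm_scale_bcontfun)
  define M where "M = onorm_on A T"
  define K where "K = onorm_on A (\<lambda>f. f + T f)"
  have M: "norm (T f) \<le> M * norm f" if "f \<in> A" for f
    unfolding M_def using bound normT that by (intro onorm_on_upper[of A T B]) auto
  have sum_le: "norm (f + T f) \<le> (1 + M) * norm f" if "f \<in> A" for f
    using norm_triangle_ineq[of f "T f"] M[OF that] by (simp add: algebra_simps)
  have K: "norm (f + T f) \<le> K * norm f" if "f \<in> A" for f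
    unfolding K_def using sum_le that by (intro onorm_on_upper[of A "\<lambda>f. f + T f" "1 + M"]) auto
  \<comment> \<open>A unit vector in \<open>A\<close> shows that \<open>M\<close> and
    \<open>K\<close> are nonnegative; any tolerance below \<open>1/2\<close> would do.\<close>
  obtain u where u: "u \<in> A" "norm u = 1"
    using somewhat_regular_peak[OF A open_UNIV UNIV_not_empty, of "1/4"] by auto
  have M0: "0 \<le> M" using M[OF u(1)] u(2) by (metis mult_1_right norm_ge_zero order_trans)
  have K0: "0 \<le> K" using K[OF u(1)] u(2) by (metis mult_1_right norm_ge_zero order_trans)
  have "K \<le> 1 + M"
    unfolding K_def onorm_on_def
  proof (rule cSUP_least)
    show "A \<noteq> {}" using zero by blast
    show "norm (f + T f) / norm f \<le> 1 + M" if "f \<in> A" for f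
      using sum_le[OF that] M0 by (cases "f = 0") (simp_all add: divide_le_eq)
  qed
  moreover have "1 + M \<le> K"
  proof (rule field_le_epsilon)
    fix \<epsilon> :: real assume "0 < \<epsilon>"
    \<comment> \<open>One \<open>e\<close> is lost in nearly attaining \<open>M\<close>, one in
      \<open>almost_Daugavet\<close>, and \<open>K * e\<close> because \<open>norm F\<close> may
      reach \<open>1 + e\<close>.\<close>
    define e where "e = \<epsilon> / (K + 2)"
    have e: "0 < e" "e * (K + 2) = \<epsilon>" using K0 \<open>0 < \<epsilon>\<close> by (auto simp: e_def)
    have "\<exists>f\<in>A. M - e < norm (T f) / norm f"
    proof (rule ccontr)
      assume "\<not> ?thesis"
      then have "M \<le> M - e" 
        unfolding M_def onorm_on_def using zero by (intro cSUP_least) (auto simp: not_less)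
      then show False using e by simp
    qed
    then obtain f where f: "f \<in> A" "M - e < norm (T f) / norm f" by blast
    \<comment> \<open>If \<open>f\<close> is 0, then \<open>f0\<close> is 0 and the quotient is 0 as
      well, so no case distinction arises.\<close>
    define f0 where "f0 = scale_bcontfun (of_real (inverse (norm f))) f"
    have f0: "f0 \<in> A" "norm f0 \<le> 1"
      using f(1) sub
    by (auto simp: f0_def norm_scale_bcontfun norm_inverse bcf.subspace_scale
        simp flip: divide_inverse_commute)
    have "norm (\<phi> f0) = norm (T f) / norm f"
      using f(1) by (simp add: f0_def scale norm_mult norm_inverse normT divide_inverse)
    then have phi: "M - e < norm (\<phi> f0)" using f(2) by simp
    obtain F where F: "F \<in> A" "norm F \<le> 1 + e"
      "1 + norm (\<phi> f0) - e \<le> norm (F + scale_bcontfun (\<phi> F) g)"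
      using almost_Daugavet[OF A iso add scale bound g f0 e(1)] by blast
    have "1 + M - 2 * e \<le> norm (F + T F)" using F phi rep by simp
    also have "\<dots> \<le> K * norm F" by (rule K) fact
    also have "\<dots> \<le> K * (1 + e)" using K0 F by (intro mult_left_mono) auto
    finally show "1 + M \<le> K + \<epsilon>" using e(2) by (simp add: algebra_simps)
  qed
  ultimately show "onorm_on A (\<lambda>f. f + T f) = 1 + onorm_on A T"
    unfolding K_def M_def by simp
qed

theorem theorem2p6:
  assumes "infinite (UNIV :: 'a::t2_space set)"
    and "locally_compact_space (euclidean :: 'a topology)"
    and "\<forall>x::'a. \<not> x isolated_in UNIV"
  shows "(\<forall>A :: ('a \<Rightarrow>\<^sub>C real) set.
            somewhat_regular A \<longrightarrow> Daugavet_property scale_bcontfun A) \<and>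
         (\<forall>A :: ('a \<Rightarrow>\<^sub>C complex) set.
            somewhat_regular A \<longrightarrow> Daugavet_property scale_bcontfun A)"
  using assms(3) by (blast intro: somewhat_regular_Daugavet)

end
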